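(* Suppose \(\delta\) is a strongly compact cardinal, \(D\) is an ultrafilter on a set of cardinality less than \(\delta\), \(X \in M_D\), and \(U\) is an \(M_D\)-ultrafilter on \(X\) that is \(j_D(\gamma)\)-complete over \(M_D\) for every \(\gamma < \delta\). Then \(U \in M_D\).
   Context: For an ultrafilter \(D\), \(j_D : V \to M_D\) denotes the ultrapower embedding of the universe by \(D\) (\(M_D\) need not be well-founded). If \(M\) is a model of set theory and \(X \in M\), an \(M\)-ultrafilter on \(X\) is an ultrafilter on the Boolean algebra \(P^M(X)\). Such \(U\) is \(\gamma\)-complete over \(M\) (for \(\gamma \in M\)) if for every \(F \subseteq U\) with \(F \in M\) and \(|F|^M < \gamma\), the intersection \((\bigcap F)^M\) computed in \(M\) belongs to \(U\). A cardinal \(\delta\) is strongly compact if it is uncountable and every \(\delta\)-complete filter extends to a \(\delta\)-complete ultrafilter. *)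

theory Defs
  imports Main "HOL-Library.Countable_Set"
begin

text \<open>
  The universe of sets is a type \<open>'v\<close> with a function \<open>elts\<close> sending a set to the collection of
  its elements, subject to the axioms of ZFC. Classes are arbitrary HOL predicates on \<open>'v\<close>, so
  separation and replacement are single axioms; in particular every HOL function restricted to
  \<open>elts x\<close> and every HOL subset of \<open>elts x\<close> is (coded by) an element of the universe.
  Choice is inherited from HOL.
\<close>

locale zfc_universe =
  fixes elts :: "'v \<Rightarrow> 'v set"
  assumes extensionality: "elts x = elts y \<Longrightarrow> x = y"
    and foundation: "wf {(x, y). x \<in> elts y}"
    and separation: "\<exists>y. elts y = {z \<in> elts x. P z}"
    and pairing: "\<exists>z. elts z = {x, y}"
    and union: "\<exists>y. elts y = \<Union> (elts ` elts x)"
    and powerset: "\<exists>y. elts y = {z. elts z \<subseteq> elts x}"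
    and replacement: "\<exists>y. elts y = f ` elts x"
    and infinity: "\<exists>w. (\<exists>e\<in>elts w. elts e = {}) \<and>
                       (\<forall>x\<in>elts w. \<exists>s\<in>elts w. elts s = insert x (elts x))"


section \<open>Notions relativized to a structure for the language of set theory\<close>

text \<open>
  The structures of interest are the universe itself and its ultrapowers, both models of ZFC.
  They may be ill-founded, so ordinals, functions and cardinalities are always understood inside
  the structure. A member \<open>a\<close> is identified with its extension \<open>ext M a\<close> where the
  mathematics treats it as a set of members of \<open>M\<close>.
\<close>

record 'm set_structure =
  univ :: "'m set"
  mem :: "'m \<Rightarrow> 'm \<Rightarrow> bool"

definition ext :: "'m set_structure \<Rightarrow> 'm \<Rightarrow> 'm set" where
  "ext M a = {x \<in> univ M. mem M x a}"

definition pair_in :: "'m set_structure \<Rightarrow> 'm \<Rightarrow> 'm \<Rightarrow> 'm \<Rightarrow> bool" where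
  "pair_in M p x y \<longleftrightarrow>
     (\<exists>s\<in>univ M. \<exists>t\<in>univ M. ext M s = {x} \<and> ext M t = {x, y} \<and> ext M p = {s, t})"

text \<open>The witness \<open>h\<close> forces the bijection \<open>f\<close> to be an element of \<open>M\<close>: its extension is exactly
  the graph of \<open>f\<close>, made of Kuratowski pairs of \<open>M\<close>.\<close>

definition eqpoll_in :: "'m set_structure \<Rightarrow> 'm \<Rightarrow> 'm \<Rightarrow> bool" where
  "eqpoll_in M a b \<longleftrightarrow>
     (\<exists>h\<in>univ M. \<exists>f. bij_betw f (ext M a) (ext M b) \<and>
        ext M h = {p \<in> univ M. \<exists>x\<in>ext M a. pair_in M p x (f x)})"

text \<open>Ordinals as transitive sets of transitive sets; this relies on \<open>M\<close> satisfying the axiom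
  of foundation, not on \<open>M\<close> being well-founded.\<close>

definition transitive_in :: "'m set_structure \<Rightarrow> 'm \<Rightarrow> bool" where
  "transitive_in M a \<longleftrightarrow> (\<forall>x\<in>ext M a. ext M x \<subseteq> ext M a)"

definition ordinal_in :: "'m set_structure \<Rightarrow> 'm \<Rightarrow> bool" where
  "ordinal_in M a \<longleftrightarrow> transitive_in M a \<and> (\<forall>x\<in>ext M a. transitive_in M x)"

definition cardinal_in :: "'m set_structure \<Rightarrow> 'm \<Rightarrow> bool" where
  "cardinal_in M k \<longleftrightarrow> k \<in> univ M \<and> ordinal_in M k \<and> (\<forall>l\<in>ext M k. \<not> eqpoll_in M l k)"

text \<open>\<open>card_less_in M a g\<close> says \<open>|a| < g\<close> in \<open>M\<close>, for an ordinal \<open>g\<close> of \<open>M\<close>.\<close>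

definition card_less_in :: "'m set_structure \<Rightarrow> 'm \<Rightarrow> 'm \<Rightarrow> bool" where
  "card_less_in M a g \<longleftrightarrow> (\<exists>k\<in>ext M g. cardinal_in M k \<and> eqpoll_in M a k)"

text \<open>The Boolean algebra \<open>P\<^sup>M(X)\<close>, and filters on it. These need not belong to \<open>M\<close>.\<close>

definition powerset_in :: "'m set_structure \<Rightarrow> 'm \<Rightarrow> 'm set" where
  "powerset_in M X = {a \<in> univ M. ext M a \<subseteq> ext M X}"

definition filter_over :: "'m set_structure \<Rightarrow> 'm \<Rightarrow> 'm set \<Rightarrow> bool" where
  "filter_over M X U \<longleftrightarrow>
     U \<subseteq> powerset_in M X \<and> X \<in> U \<and> (\<forall>a\<in>U. ext M a \<noteq> {}) \<and>
     (\<forall>a\<in>U. \<forall>b\<in>U. \<exists>c\<in>U. ext M c = ext M a \<inter> ext M b) \<and>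
     (\<forall>a\<in>U. \<forall>b\<in>powerset_in M X. ext M a \<subseteq> ext M b \<longrightarrow> b \<in> U)"

definition ultrafilter_over :: "'m set_structure \<Rightarrow> 'm \<Rightarrow> 'm set \<Rightarrow> bool" where
  "ultrafilter_over M X U \<longleftrightarrow>
     filter_over M X U \<and>
     (\<forall>a\<in>powerset_in M X. a \<in> U \<or> (\<exists>c\<in>U. ext M c = ext M X - ext M a))"

text \<open>Only families \<open>F\<close> in \<open>M\<close> are considered; the intersection of the empty family is \<open>X\<close>.\<close>

definition complete_over :: "'m set_structure \<Rightarrow> 'm \<Rightarrow> 'm set \<Rightarrow> 'm \<Rightarrow> bool" where
  "complete_over M X U g \<longleftrightarrow>
     (\<forall>F\<in>univ M. ext M F \<subseteq> U \<and> card_less_in M F g \<longrightarrow>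
        (\<exists>c\<in>U. ext M c = {x \<in> ext M X. \<forall>a\<in>ext M F. x \<in> ext M a}))"


section \<open>The universe, strongly compact cardinals and ultrapowers\<close>

definition universe :: "('v \<Rightarrow> 'v set) \<Rightarrow> 'v set_structure" where
  "universe elts = \<lparr>univ = UNIV, mem = (\<lambda>x y. x \<in> elts y)\<rparr>"

definition strongly_compact :: "('v \<Rightarrow> 'v set) \<Rightarrow> 'v \<Rightarrow> bool" where
  "strongly_compact elts \<delta> \<longleftrightarrow>
     cardinal_in (universe elts) \<delta> \<and> uncountable (elts \<delta>) \<and>
     (\<forall>S F. filter_over (universe elts) S F \<and> complete_over (universe elts) S F \<delta> \<longrightarrow>
        (\<exists>W. F \<subseteq> W \<and> ultrafilter_over (universe elts) S W \<and>
             complete_over (universe elts) S W \<delta>))"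

text \<open>
  The ultrapower of the universe by an ultrafilter \<open>D\<close> on the set \<open>I\<close>. Functions from \<open>I\<close> to the
  universe are represented by total functions on \<open>'v\<close>; values outside \<open>elts I\<close> are irrelevant,
  as functions agreeing on \<open>elts I\<close> lie in the same class.
\<close>

definition ae :: "('v \<Rightarrow> 'v set) \<Rightarrow> 'v \<Rightarrow> 'v set \<Rightarrow> ('v \<Rightarrow> bool) \<Rightarrow> bool" where
  "ae elts I D P \<longleftrightarrow> (\<exists>d\<in>D. elts d = {i \<in> elts I. P i})"

definition ultra_class ::
    "('v \<Rightarrow> 'v set) \<Rightarrow> 'v \<Rightarrow> 'v set \<Rightarrow> ('v \<Rightarrow> 'v) \<Rightarrow> ('v \<Rightarrow> 'v) set" where
  "ultra_class elts I D f = {g. ae elts I D (\<lambda>i. f i = g i)}"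

definition ultrapower ::
    "('v \<Rightarrow> 'v set) \<Rightarrow> 'v \<Rightarrow> 'v set \<Rightarrow> ('v \<Rightarrow> 'v) set set_structure" where
  "ultrapower elts I D =
     \<lparr>univ = range (ultra_class elts I D),
      mem = (\<lambda>a b. \<exists>f\<in>a. \<exists>g\<in>b. ae elts I D (\<lambda>i. f i \<in> elts (g i)))\<rparr>"

definition ultrapower_embedding ::
    "('v \<Rightarrow> 'v set) \<Rightarrow> 'v \<Rightarrow> 'v set \<Rightarrow> 'v \<Rightarrow> ('v \<Rightarrow> 'v) set" where
  "ultrapower_embedding elts I D x = ultra_class elts I D (\<lambda>i. x)"

end

theory Submission
  imports Defs
begin

text \<open>
  Let \<open>X = [X\<^sub>i]\<close>. Each \<open>x \<in> \<Prod>X\<^sub>i\<close> decides for each \<open>f \<in> \<Prod>P(X\<^sub>i)\<close> whether \<open>[x] \<in> [f]\<close>. Since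
  \<open>\<delta>\<close> is a strong limit and \<open>U\<close> is complete, fewer than \<open>\<delta>\<close> many such \<open>f\<close> generate a partition of \<open>X\<close>
  in \<open>M\<^sub>D\<close> with one piece in \<open>U\<close>, and any \<open>[x]\<close> in that piece satisfies \<open>[x] \<in> [f] \<longleftrightarrow> [f] \<in> U\<close> for all of
  them. Hence the sets \<open>B\<^sub>f = {x. [x] \<in> [f] \<longleftrightarrow> [f] \<in> U}\<close> generate a \<open>\<delta>\<close>-complete filter, which
  extends to a \<open>\<delta>\<close>-complete ultrafilter \<open>W\<close>. Let \<open>g\<^sub>i = {Y \<subseteq> X\<^sub>i. {x. x\<^sub>i \<in> Y} \<in> W}\<close>. As \<open>|I| < \<delta>\<close>,
  for every \<open>f\<close> there is \<open>x \<in> B\<^sub>f\<close> with \<open>x\<^sub>i \<in> f\<^sub>i \<longleftrightarrow> f\<^sub>i \<in> g\<^sub>i\<close> for all \<open>i\<close>, so \<open>[f] \<in> U \<longleftrightarrow> [f] \<in> [g]\<close>.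
\<close>

unbundle cardinal_syntax

section \<open>Strongly compact cardinals\<close>

text \<open>Families are external and \<open>\<kappa>\<close> is a cardinal in the sense of HOL. The
  top element and binary meets have no clauses of their own: an empty and a two-element
  \<open>G\<close> supply them when \<open>\<kappa>\<close> is infinite.\<close>

definition complete_filter :: "'k rel \<Rightarrow> 'a set \<Rightarrow> 'a set set \<Rightarrow> bool" where
  "complete_filter \<kappa> A F \<longleftrightarrow> F \<subseteq> Pow A \<and> {} \<notin> F \<and> (\<forall>a\<in>F. \<forall>b. a \<subseteq> b \<and> b \<subseteq> A \<longrightarrow> b \<in> F) \<and>
     (\<forall>G\<subseteq>F. |G| <o \<kappa> \<longrightarrow> A \<inter> \<Inter>G \<in> F)"

definition complete_ultrafilter :: "'k rel \<Rightarrow> 'a set \<Rightarrow> 'a set set \<Rightarrow> bool" where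
  "complete_ultrafilter \<kappa> A F \<longleftrightarrow> complete_filter \<kappa> A F \<and> (\<forall>a\<subseteq>A. a \<in> F \<or> A - a \<in> F)"

lemma card_of_finite_less:
  assumes "finite A" "infinite B" shows "|A| <o |B|"
proof -
  have "\<not> |B| \<le>o |A|" using assms card_of_ordLeq_finite by blast
  then show ?thesis by (simp only: not_ordLeq_iff_ordLess[OF card_of_Well_order card_of_Well_order])
qed

lemma complete_filter_INT:
  assumes "complete_filter \<kappa> A F" "|T| <o \<kappa>" "\<And>t. t \<in> T \<Longrightarrow> C t \<in> F"
  shows "{s\<in>A. \<forall>t\<in>T. s \<in> C t} \<in> F"
proof -
  have "|C ` T| <o \<kappa>" using assms(2) card_of_image ordLeq_ordLess_trans by blast
  moreover have "C ` T \<subseteq> F" using assms(3) by auto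
  ultimately have "A \<inter> \<Inter>(C ` T) \<in> F" using assms(1) unfolding complete_filter_def by blast
  moreover have "A \<inter> \<Inter>(C ` T) = {s\<in>A. \<forall>t\<in>T. s \<in> C t}" by auto
  ultimately show ?thesis by simp
qed

lemma complete_filter_disjoint:
  assumes F: "complete_filter ( |K| ) A F" and K: "infinite K" and "a \<in> F" "b \<in> F"
  shows "a \<inter> b \<noteq> {}"
proof -
  have "|{a, b}| <o |K|" using K by (simp add: card_of_finite_less)
  then have "A \<inter> \<Inter>{a, b} \<in> F"
    using assms unfolding complete_filter_def by (metis empty_subsetI insert_subset)
  then show ?thesis using F unfolding complete_filter_def by auto
qed

text \<open>Read \<open>c s\<close> as a code of \<open>s\<close> by a subset of \<open>T\<close>.
  \<open>W\<close> decides each bit \<open>t\<close>, and intersecting the decided sets over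
  \<open>T\<close> leaves only points with code \<open>R\<close>, hence exactly one.
  \<open>INT\<close> replaces completeness so that \<open>T\<close> may be as large as \<delta>
  itself.\<close>

lemma complete_ultrafilter_singleton:
  assumes W: "complete_ultrafilter \<kappa> A W"
    and INT: "\<And>C. (\<And>t. t \<in> T \<Longrightarrow> C t \<in> W) \<Longrightarrow> {s\<in>A. \<forall>t\<in>T. s \<in> C t} \<in> W"
    and c: "inj_on c A" "c ` A \<subseteq> Pow T"
  shows "\<exists>s\<in>A. {s} \<in> W"
proof -
  define R where "R = {t\<in>T. {s\<in>A. t \<in> c s} \<in> W}"
  define C where "C t = {s\<in>A. t \<in> c s \<longleftrightarrow> t \<in> R}" for t
  have "C t \<in> W" if "t \<in> T" for t
  proof -
    have "{s\<in>A. t \<in> c s} \<in> W \<or> A - {s\<in>A. t \<in> c s} \<in> W"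
      using W by (auto simp: complete_ultrafilter_def)
    moreover have "A - {s\<in>A. t \<in> c s} = {s\<in>A. t \<notin> c s}" by auto
    ultimately show ?thesis
      using that unfolding C_def R_def by (cases "{s\<in>A. t \<in> c s} \<in> W") auto
  qed
  then have I: "{s\<in>A. \<forall>t\<in>T. s \<in> C t} \<in> W" by (rule INT)
  have "{} \<notin> W" using W unfolding complete_ultrafilter_def complete_filter_def by blast
  with I have "{s\<in>A. \<forall>t\<in>T. s \<in> C t} \<noteq> {}" by metis
  then obtain s where s: "s \<in> A" "\<forall>t\<in>T. s \<in> C t" by blast
  have "c s' = R" if "s' \<in> A" "\<forall>t\<in>T. s' \<in> C t" for s'
    using that c(2) unfolding C_def R_def by auto
  with s have "{s\<in>A. \<forall>t\<in>T. s \<in> C t} = {s}"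
    by (auto intro: inj_onD[OF c(1)])
  with I s show ?thesis by auto
qed

text \<open>Complementation turns an ideal of small sets into a filter. Small will mean of size at
  most \<delta> in one application and of size less than \<delta> in the other.\<close>

lemma complete_filter_cosmall:
  assumes neg: "\<not> P A"
    and mono: "\<And>x y. P x \<Longrightarrow> y \<subseteq> x \<Longrightarrow> P y"
    and UN: "\<And>G. |G| <o \<kappa> \<Longrightarrow> (\<And>x. x \<in> G \<Longrightarrow> P x) \<Longrightarrow> P (\<Union>G)"
  shows "complete_filter \<kappa> A {Z. Z \<subseteq> A \<and> P (A - Z)}"
proof -
  have "P (A - (A \<inter> \<Inter>G))" if G: "G \<subseteq> {Z. Z \<subseteq> A \<and> P (A - Z)}" "|G| <o \<kappa>" for G
  proof -
    have "|(\<lambda>Z. A - Z) ` G| <o \<kappa>" using G(2) card_of_image ordLeq_ordLess_trans by blast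
    then have "P (\<Union>((\<lambda>Z. A - Z) ` G))" using G(1) by (intro UN) auto
    then show ?thesis by (rule mono) auto
  qed
  moreover have "P (A - b)" if "P (A - a)" "a \<subseteq> b" for a b
    using that by (auto intro: mono)
  ultimately show ?thesis using neg unfolding complete_filter_def by auto
qed

context zfc_universe
begin

lemma subset_is_set: "Z \<subseteq> elts x \<Longrightarrow> \<exists>y. elts y = Z"
proof -
  assume "Z \<subseteq> elts x"
  then have "{z\<in>elts x. z \<in> Z} = Z" by auto
  with separation[of x "\<lambda>z. z \<in> Z"] show ?thesis by simp
qed

lemma elts_image_powerset:
  assumes "elts S = {z. elts z \<subseteq> elts x}"
  shows "elts ` elts S = Pow (elts x)"
proof (intro equalityI subsetI)
  fix Y assume Y: "Y \<in> Pow (elts x)"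
  then obtain y where "elts y = Y" using subset_is_set by blast
  with Y assms show "Y \<in> elts ` elts S" by auto
qed (use assms in auto)

end

section \<open>Regularity and the strong limit property of \<delta>\<close>

locale compact_universe = zfc_universe elts for elts :: "'v \<Rightarrow> 'v set" +
  fixes \<delta> :: 'v
  assumes cardinal_delta: "cardinal_in (universe elts) \<delta>"
    and infinite_delta: "infinite (elts \<delta>)"
    and extends: "\<And>S F. complete_filter ( |elts \<delta>| ) (elts S) F \<Longrightarrow>
      \<exists>W. F \<subseteq> W \<and> complete_ultrafilter ( |elts \<delta>| ) (elts S) W"
begin

text \<open>If \<open>\<delta>\<close> were singular, \<open>\<delta>\<close>-complete ultrafilters would be closed under intersections of
  \<open>\<delta>\<close> many sets, hence principal on \<open>P(\<delta>)\<close>; but the sets with complement of size at most \<open>\<delta>\<close>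
  form a \<open>\<delta>\<close>-complete filter there.\<close>

lemma stable_delta: "stable |elts \<delta>|"
proof (rule ccontr)
  let ?K = "|elts \<delta>|"
  assume "\<not> stable ?K"
  \<comment> \<open>A singular \<delta> gives fewer than \<delta> sets, each smaller than \<delta>,
    whose disjoint union is at least as large as \<delta>.\<close>
  then obtain A :: "'v set" and F :: "'v \<Rightarrow> 'v set" where A: "|A| <o ?K" "\<forall>a\<in>A. |F a| <o ?K"
    and "\<not> |SIGMA a:A. F a| <o ?K"
    unfolding stable_def by auto
  then have "?K \<le>o |SIGMA a:A. F a|"
    by (simp add: not_ordLess_iff_ordLeq[OF card_of_Well_order card_of_Well_order])
  then obtain g where g: "inj_on g (elts \<delta>)" "g ` elts \<delta> \<subseteq> (SIGMA a:A. F a)"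
    unfolding card_of_ordLeq[symmetric] by (elim exE conjE)
  \<comment> \<open>Pulling the disjoint union back along \<open>g\<close> splits \<delta> into
    fewer than \<delta> fibres, each of size less than \<delta>.\<close>
  define B where "B a = {x\<in>elts \<delta>. fst (g x) = a}" for a
  have B: "|B a| <o ?K" if "a \<in> A" for a
  proof -
    have "inj_on (\<lambda>x. snd (g x)) (B a)"
      using g(1) unfolding B_def
      by (intro inj_onI) (metis (mono_tags, lifting) inj_onD mem_Collect_eq prod.expand)
    moreover have "(\<lambda>x. snd (g x)) ` B a \<subseteq> F a"
      using g(2) unfolding B_def by (auto simp: subset_iff)
    ultimately have "|B a| \<le>o |F a|" using card_of_ordLeq by blast
    then show ?thesis using A(2) that ordLeq_ordLess_trans by blast
  qed
  have "fst (g x) \<in> A" if "x \<in> elts \<delta>" for x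
    using g(2) that by (metis image_subset_iff mem_Sigma_iff prod.collapse)
  then have UB: "elts \<delta> = (\<Union>a\<in>A. B a)" unfolding B_def by auto
  obtain S where S: "elts S = {z. elts z \<subseteq> elts \<delta>}" using powerset by blast
  have Pow: "elts ` elts S = Pow (elts \<delta>)" using S by (rule elts_image_powerset)
  let ?F = "{Z. Z \<subseteq> elts S \<and> |elts S - Z| \<le>o ?K}"
  have "complete_filter ?K (elts S) ?F"
  proof (rule complete_filter_cosmall)
    have "|Pow (elts \<delta>)| \<le>o |elts S|"
      unfolding Pow[symmetric] by (rule card_of_image)
    then show "\<not> |elts S| \<le>o ?K"
      using not_ordLess_ordLeq[OF ordLess_ordLeq_trans[OF card_of_Pow]] by blast
    show "|y| \<le>o ?K" if "|x| \<le>o ?K" "y \<subseteq> x" for x y :: "'v set"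
      using that card_of_mono1 ordLeq_transitive by blast
    show "|\<Union>G| \<le>o ?K" if "|G| <o ?K" "\<And>x. x \<in> G \<Longrightarrow> |x| \<le>o ?K" for G :: "'v set set"
      using card_of_UNION_ordLeq_infinite[OF infinite_delta ordLess_imp_ordLeq[OF that(1)],
          of "\<lambda>x. x"] that(2) by simp
  qed
  then obtain W where W: "?F \<subseteq> W" "complete_ultrafilter ?K (elts S) W" using extends by blast
  then have kW: "complete_filter ?K (elts S) W" unfolding complete_ultrafilter_def by auto
  have "\<exists>s\<in>elts S. {s} \<in> W"
  proof (rule complete_ultrafilter_singleton[OF W(2), where T = "elts \<delta>" and c = elts])
    \<comment> \<open>Intersect inside each fibre first and then over the fibres; both stages
      involve fewer than \<delta> sets.\<close>
    show "{s\<in>elts S. \<forall>t\<in>elts \<delta>. s \<in> C t} \<in> W" if C: "\<And>t. t \<in> elts \<delta> \<Longrightarrow> C t \<in> W" for C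
    proof -
      have "{s\<in>elts S. \<forall>t\<in>B a. s \<in> C t} \<in> W" if "a \<in> A" for a
        by (rule complete_filter_INT[OF kW B[OF that]]) (use C B_def in auto)
      then have "{s\<in>elts S. \<forall>a\<in>A. s \<in> {s\<in>elts S. \<forall>t\<in>B a. s \<in> C t}} \<in> W"
        by (rule complete_filter_INT[OF kW A(1)])
      moreover have "{s\<in>elts S. \<forall>a\<in>A. s \<in> {s\<in>elts S. \<forall>t\<in>B a. s \<in> C t}}
          = {s\<in>elts S. \<forall>t\<in>elts \<delta>. s \<in> C t}" using UB by auto
      ultimately show ?thesis by simp
    qed
  qed (use S in \<open>auto simp: inj_on_def intro: extensionality\<close>)
  then obtain s where s: "s \<in> elts S" "{s} \<in> W" by auto
  \<comment> \<open>The singleton is small, so its complement lies in \<open>?F\<close> and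
    therefore in \<open>W\<close>, beside \<open>{s}\<close> itself.\<close>
  have "elts \<delta> \<noteq> {}" using infinite_delta by auto
  then have "|{s}| \<le>o ?K" by (rule card_of_singl_ordLeq)
  moreover have "elts S - (elts S - {s}) = {s}" using s(1) by blast
  ultimately have "elts S - {s} \<in> ?F" by (metis (mono_tags, lifting) Diff_subset mem_Collect_eq)
  with W(1) have "elts S - {s} \<in> W" by (rule subsetD)
  then show False using complete_filter_disjoint[OF kW infinite_delta s(2)] by blast
qed

text \<open>Otherwise \<open>\<delta>\<close> injects into \<open>P(T)\<close>, where a \<open>|T|\<^sup>+\<close>-complete ultrafilter is principal.\<close>

lemma strong_limit_delta:
  fixes T :: "'t set"
  assumes T: "|T| <o |elts \<delta>|"
  shows "|Pow T| <o |elts \<delta>|"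
proof (rule ccontr)
  let ?K = "|elts \<delta>|"
  assume "\<not> |Pow T| <o ?K"
  then have "?K \<le>o |Pow T|"
    by (simp add: not_ordLess_iff_ordLeq[OF card_of_Well_order card_of_Well_order])
  then obtain c where c: "inj_on c (elts \<delta>)" "c ` elts \<delta> \<subseteq> Pow T"
    unfolding card_of_ordLeq[symmetric] by (elim exE conjE)
  \<comment> \<open>By regularity, fewer than \<delta> of the complements still have a union smaller
    than \<delta>, so \<open>?F\<close> is complete.\<close>
  let ?F = "{Z. Z \<subseteq> elts \<delta> \<and> |elts \<delta> - Z| <o ?K}"
  have "complete_filter ?K (elts \<delta>) ?F"
  proof (rule complete_filter_cosmall)
    show "\<not> |elts \<delta>| <o ?K" using ordLess_irreflexive by blast
    show "|y| <o ?K" if "|x| <o ?K" "y \<subseteq> x" for x y :: "'v set"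
      using that card_of_mono1 ordLeq_ordLess_trans by blast
    show "|\<Union>G| <o ?K" if "|G| <o ?K" "\<And>x. x \<in> G \<Longrightarrow> |x| <o ?K" for G :: "'v set set"
      using stable_UNION[OF stable_delta that(1), of "\<lambda>x. x"] that(2) by auto
  qed
  then obtain W where W: "?F \<subseteq> W" "complete_ultrafilter ?K (elts \<delta>) W" using extends by blast
  then have kW: "complete_filter ?K (elts \<delta>) W" unfolding complete_ultrafilter_def by auto
  obtain s where s: "s \<in> elts \<delta>" "{s} \<in> W"
    using complete_ultrafilter_singleton[OF W(2) complete_filter_INT[OF kW T] c] by blast
  have "|{s}| <o ?K" using infinite_delta by (simp add: card_of_finite_less)
  moreover have "elts \<delta> - (elts \<delta> - {s}) = {s}" using s(1) by blast
  ultimately have "elts \<delta> - {s} \<in> ?F" by (metis (mono_tags, lifting) Diff_subset mem_Collect_eq)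
  with W(1) have "elts \<delta> - {s} \<in> W" by (rule subsetD)
  then show False using complete_filter_disjoint[OF kW infinite_delta s(2)] by blast
qed

end

section \<open>Cardinals of the universe\<close>

lemma univ_universe [simp]: "univ (universe elts) = UNIV"
  and ext_universe [simp]: "ext (universe elts) a = elts a"
  by (auto simp: universe_def ext_def)

text \<open>\<open>M\<close> is not assumed extensional, so the Kuratowski argument is run on the
  extensions of \<open>s\<close> and \<open>t\<close> instead of on \<open>s\<close> and
  \<open>t\<close> themselves.\<close>

lemma pair_in_inject:
  assumes "pair_in M p x y" "pair_in M p x' y'"
  shows "x = x' \<and> y = y'"
proof -
  obtain s t where st: "ext M s = {x}" "ext M t = {x, y}" "ext M p = {s, t}"
    using assms(1) unfolding pair_in_def by blast
  obtain s' t' where st': "ext M s' = {x'}" "ext M t' = {x', y'}" "ext M p = {s', t'}"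
    using assms(2) unfolding pair_in_def by blast
  have "{s, t} = {s', t'}" using st(3) st'(3) by simp
  then have "{{x}, {x, y}} = {{x'}, {x', y'}}"
    unfolding st(1,2)[symmetric] st'(1,2)[symmetric] doubleton_eq_iff by blast
  then show ?thesis by (auto simp: doubleton_eq_iff)
qed

context zfc_universe
begin

abbreviation "V \<equiv> universe elts"

lemma ex_pair: "\<exists>p. pair_in V p x y"
proof -
  obtain s t where "elts s = {x, x}" "elts t = {x, y}" using pairing by metis
  moreover obtain p where "elts p = {s, t}" using pairing by metis
  ultimately show ?thesis unfolding pair_in_def by auto
qed

text \<open>Replacement accepts any HOL function, so an external bijection has its graph in the
  universe.\<close>

lemma eqpoll_universe_iff: "eqpoll_in V a b \<longleftrightarrow> |elts a| =o |elts b|"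
proof
  assume "eqpoll_in V a b"
  then show "|elts a| =o |elts b|"
    unfolding eqpoll_in_def by (auto simp: card_of_ordIso[symmetric])
next
  assume "|elts a| =o |elts b|"
  then obtain f where f: "bij_betw f (elts a) (elts b)"
    unfolding card_of_ordIso[symmetric] by (elim exE)
  obtain pr where pr: "\<And>x y. pair_in V (pr x y) x y" using ex_pair by metis
  have "pair_in V p x y \<Longrightarrow> p = pr x y" for p x y
    using pr[of x y] unfolding pair_in_def by (metis ext_universe extensionality)
  then have iff: "pair_in V p x y \<longleftrightarrow> p = pr x y" for p x y using pr by blast
  obtain h where "elts h = (\<lambda>x. pr x (f x)) ` elts a"
    using replacement[of "\<lambda>x. pr x (f x)" a] by blast
  with f show "eqpoll_in V a b"
    unfolding eqpoll_in_def by (intro bexI[of _ h] exI[of _ f]) (auto simp: iff)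
qed

section \<open>Membership on ordinals and sizes below a cardinal\<close>

lemma mem_irrefl: "x \<notin> elts x"
  using wf_not_refl[OF foundation, of x] by simp

lemma mem_asym: "x \<in> elts y \<Longrightarrow> y \<notin> elts x"
  using wf_not_sym[OF foundation, of x y] by simp

lemma ordinal_elem_subset:
  assumes "ordinal_in V \<alpha>" "x \<in> elts \<alpha>"
  shows "elts x \<subseteq> elts \<alpha>"
  using assms unfolding ordinal_in_def transitive_in_def by simp

lemma ordinal_elem_trans:
  assumes "ordinal_in V \<alpha>" "x \<in> elts \<alpha>" "y \<in> elts z" "z \<in> elts x"
  shows "y \<in> elts x"
proof -
  have "transitive_in V x" using assms(1,2) unfolding ordinal_in_def by simp
  then have "elts z \<subseteq> elts x" using assms(4) unfolding transitive_in_def by simp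
  then show ?thesis using assms(3) by (rule subsetD)
qed

text \<open>Nested induction on membership, first in \<open>x\<close> and then in \<open>y\<close>:
  if neither is a member of the other, the induction hypotheses and transitivity give them the same
  elements.\<close>

lemma ordinal_trichotomy:
  assumes \<alpha>: "ordinal_in V \<alpha>" and "x \<in> elts \<alpha>" "y \<in> elts \<alpha>"
  shows "x \<in> elts y \<or> x = y \<or> y \<in> elts x"
proof -
  have sub: "z \<in> elts \<alpha>" if "z \<in> elts x" "x \<in> elts \<alpha>" for z x
    using ordinal_elem_subset[OF \<alpha>] that by blast
  have tr: "w \<in> elts x" if "w \<in> elts z" "z \<in> elts x" "x \<in> elts \<alpha>" for w z x
    using ordinal_elem_trans[OF \<alpha>] that by blast
  have "x \<in> elts \<alpha> \<longrightarrow> (\<forall>y\<in>elts \<alpha>. x \<in> elts y \<or> x = y \<or> y \<in> elts x)" for x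
  proof (induction x rule: wf_induct_rule[OF foundation])
    case (1 x)
    have "x \<in> elts y \<or> x = y \<or> y \<in> elts x" if x: "x \<in> elts \<alpha>" and "y \<in> elts \<alpha>" for y
      using that(2)
    proof (induction y rule: wf_induct_rule[OF foundation])
      case (1 y)
      show ?case
      proof (cases "x \<in> elts y \<or> y \<in> elts x")
        case False
        have "z \<in> elts y" if "z \<in> elts x" for z
          using "1.prems" \<open>\<And>y. (y, x) \<in> {(x, y). x \<in> elts y} \<Longrightarrow> _ y\<close>[of z] that x False
          by (auto dest: sub tr)
        moreover have "z \<in> elts x" if "z \<in> elts y" for z
          using "1.IH"[of z] that "1.prems" x False by (auto dest: sub tr)
        ultimately show ?thesis using extensionality by blast
      qed blast
    qed
    then show ?case by blast
  qed
  with assms show ?thesis by blast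
qed

text \<open>Membership well-orders \<kappa>, so a smaller set is equipotent with a proper initial
  segment, that is, with an element of \<kappa>; a membership-minimal such element is a
  cardinal.\<close>

lemma card_below_cardinal:
  assumes \<kappa>: "cardinal_in V \<kappa>" and a: "|elts a| <o |elts \<kappa>|"
  shows "\<exists>l\<in>elts \<kappa>. cardinal_in V l \<and> |elts a| =o |elts l|"
proof -
  have ord: "ordinal_in V \<kappa>" using \<kappa> unfolding cardinal_in_def by auto
  note sub = ordinal_elem_subset[OF ord] and tr = ordinal_elem_trans[OF ord]
  define r where "r = {(x, y). x \<in> elts \<kappa> \<and> y \<in> elts \<kappa> \<and> (x \<in> elts y \<or> x = y)}"
  have "wf (r - Id)"
    by (rule wf_subset[OF foundation]) (auto simp: r_def)
  moreover have "trans r" unfolding r_def trans_def using tr by blast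
  moreover have "antisym r" unfolding r_def antisym_def using mem_asym by blast
  moreover have "total_on (elts \<kappa>) r"
    unfolding r_def total_on_def using ordinal_trichotomy[OF ord] by blast
  moreover have "refl_on (elts \<kappa>) r" "r \<subseteq> elts \<kappa> \<times> elts \<kappa>"
    unfolding r_def refl_on_def by auto
  ultimately have r: "well_order_on (elts \<kappa>) r"
    unfolding well_order_on_def linear_order_on_def partial_order_on_def preorder_on_def by blast
  then have F: "Field r = elts \<kappa>" using well_order_on_Field by blast
  have "|elts a| <o r" using a card_of_least[OF r] by (rule ordLess_ordLeq_trans)
  then obtain l where l: "l \<in> elts \<kappa>" "|elts a| =o Restr r (underS r l)"
    using ordLess_iff_ordIso_Restr[OF _ card_of_Well_order, of r "elts a"] r F by auto
  have "underS r l = elts l"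
    using l(1) sub mem_irrefl unfolding underS_def r_def by auto
  moreover have "Field (Restr r (elts l)) = elts l"
    using l(1) sub unfolding Field_def r_def by auto
  ultimately have "|elts a| =o |elts l|"
    using card_of_cong[OF l(2)] by (simp add: Field_card_of)
  with l(1) have "l \<in> {l\<in>elts \<kappa>. |elts a| =o |elts l| }" by simp
  from wfE_min[OF foundation this] obtain m where
    m: "m \<in> elts \<kappa>" "|elts a| =o |elts m|"
      "\<And>y. y \<in> elts m \<Longrightarrow> y \<in> elts \<kappa> \<Longrightarrow> \<not> |elts a| =o |elts y|"
    by auto
  have "ordinal_in V m"
    using ord sub m(1) unfolding ordinal_in_def transitive_in_def by (auto dest: tr)
  moreover have "\<not> |elts y| =o |elts m|" if "y \<in> elts m" for y
    using m that sub[OF m(1)] ordIso_transitive[OF m(2) ordIso_symmetric] by blast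
  ultimately have "cardinal_in V m"
    unfolding cardinal_in_def by (simp add: eqpoll_universe_iff)
  with m show ?thesis by blast
qed

text \<open>Bridge from the internal comparison to HOL cardinals. An element of the cardinal
  \<kappa> is a subset of it and not equipotent with it, hence strictly smaller.\<close>

lemma card_less_universe_iff:
  assumes \<kappa>: "cardinal_in V \<kappa>"
  shows "card_less_in V a \<kappa> \<longleftrightarrow> |elts a| <o |elts \<kappa>|"
proof
  assume "card_less_in V a \<kappa>"
  then obtain k where k: "k \<in> elts \<kappa>" "|elts a| =o |elts k|"
    unfolding card_less_in_def by (auto simp: eqpoll_universe_iff)
  have "elts k \<subseteq> elts \<kappa>"
    using \<kappa> k(1) unfolding cardinal_in_def ordinal_in_def transitive_in_def by auto
  then have "|elts k| \<le>o |elts \<kappa>|" by (rule card_of_mono1)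
  moreover have "\<not> |elts k| =o |elts \<kappa>|"
    using \<kappa> k(1) unfolding cardinal_in_def by (simp add: eqpoll_universe_iff)
  ultimately have "|elts k| <o |elts \<kappa>|"
    using ordLeq_iff_ordLess_or_ordIso by blast
  with k(2) show "|elts a| <o |elts \<kappa>|" by (rule ordIso_ordLess_trans)
next
  assume "|elts a| <o |elts \<kappa>|"
  from card_below_cardinal[OF \<kappa> this] show "card_less_in V a \<kappa>"
    unfolding card_less_in_def by (simp add: eqpoll_universe_iff)
qed

text \<open>\<open>elts\<close> identifies the members of the powerset of \<open>S\<close> with the
  external subsets of \<open>elts S\<close>, so the filter can be moved into the universe, extended
  there and moved back.\<close>

lemma strongly_compact_extends:
  assumes \<delta>: "strongly_compact elts \<delta>" and F: "complete_filter ( |elts \<delta>| ) (elts S) F"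
  shows "\<exists>W. F \<subseteq> W \<and> complete_ultrafilter ( |elts \<delta>| ) (elts S) W"
proof -
  let ?K = "|elts \<delta>|"
  have card: "cardinal_in V \<delta>" and inf: "infinite (elts \<delta>)"
    using \<delta> countable_finite unfolding strongly_compact_def by auto
  have inj: "inj_on elts X" for X :: "'v set" using extensionality by (auto intro: inj_onI)
  define F' where "F' = {b. elts b \<in> F}"
  have FS: "a \<subseteq> elts S" if "a \<in> F" for a using F that unfolding complete_filter_def by auto
  have inter: "elts S \<inter> \<Inter>G \<in> F" if "G \<subseteq> F" "|G| <o ?K" for G
    using F that unfolding complete_filter_def by simp
  have top: "elts S \<in> F"
    using inter[of "{}"] inf by (simp add: card_of_finite_less)
  have "filter_over V S F'"
  proof -
    have "\<exists>c. elts c \<in> F \<and> elts c = elts a \<inter> elts b" if "elts a \<in> F" "elts b \<in> F" for a b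
    proof -
      have "elts S \<inter> \<Inter>{elts a, elts b} \<in> F"
        using that inf by (intro inter) (auto simp: card_of_finite_less)
      moreover have "elts S \<inter> \<Inter>{elts a, elts b} = elts a \<inter> elts b"
        using FS that by auto
      ultimately show ?thesis using subset_is_set[of "elts a \<inter> elts b" a] by (metis inf_le1)
    qed
    moreover have "elts b \<in> F" if "elts a \<in> F" "elts a \<subseteq> elts b" "elts b \<subseteq> elts S" for a b
      using F that unfolding complete_filter_def by simp
    moreover have "{} \<notin> F" using F unfolding complete_filter_def by simp
    ultimately show ?thesis
      using top FS unfolding filter_over_def F'_def powerset_in_def by (simp add: subset_iff) metis
  qed
  moreover have "complete_over V S F' \<delta>"
    unfolding complete_over_def
  proof (intro ballI impI)
    fix G assume G: "ext V G \<subseteq> F' \<and> card_less_in V G \<delta>"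
    then have "|elts G| <o ?K" by (simp add: card_less_universe_iff[OF card])
    then have "|elts ` elts G| <o ?K" by (rule ordLeq_ordLess_trans[OF card_of_image])
    then have "elts S \<inter> \<Inter>(elts ` elts G) \<in> F"
      using G by (intro inter) (auto simp: F'_def)
    moreover obtain c where "elts c = elts S \<inter> \<Inter>(elts ` elts G)"
      using subset_is_set[of "elts S \<inter> \<Inter>(elts ` elts G)" S] by auto
    ultimately show "\<exists>c\<in>F'. ext V c = {x \<in> ext V S. \<forall>a\<in>ext V G. x \<in> ext V a}"
      unfolding F'_def by (intro bexI[of _ c]) auto
  qed
  ultimately obtain W where W: "F' \<subseteq> W" "ultrafilter_over V S W" "complete_over V S W \<delta>"
    using \<delta> unfolding strongly_compact_def by blast
  have Wf: "filter_over V S W" using W(2) unfolding ultrafilter_over_def by auto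
  have WS: "elts a \<subseteq> elts S" if "a \<in> W" for a
    using Wf that unfolding filter_over_def powerset_in_def by auto
  have "F \<subseteq> elts ` W"
  proof
    fix a assume a: "a \<in> F"
    then obtain b where "elts b = a" using subset_is_set[OF FS] by blast
    with a W(1) show "a \<in> elts ` W" unfolding F'_def by auto
  qed
  moreover have "complete_filter ?K (elts S) (elts ` W)"
    unfolding complete_filter_def
  proof (intro conjI ballI allI impI)
    show "elts ` W \<subseteq> Pow (elts S)" using WS by auto
    show "{} \<notin> elts ` W" using Wf unfolding filter_over_def by auto
  next
    fix a b assume "a \<in> elts ` W" and b: "a \<subseteq> b \<and> b \<subseteq> elts S"
    moreover obtain b' where "elts b' = b" using b subset_is_set by blast
    ultimately show "b \<in> elts ` W"
      using Wf unfolding filter_over_def powerset_in_def by auto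
  next
    fix G assume G: "G \<subseteq> elts ` W" "|G| <o ?K"
    obtain P where P: "elts P = {z. elts z \<subseteq> elts S}" using powerset by blast
    \<comment> \<open>The codes of \<open>G\<close> in \<open>W\<close> lie in one powerset and so
      form a set, to which the internal completeness of \<open>W\<close> applies.\<close>
    have "{b\<in>W. elts b \<in> G} \<subseteq> elts P" using P WS by auto
    then obtain g where g: "elts g = {b\<in>W. elts b \<in> G}" using subset_is_set by blast
    have "elts ` elts g = G" using G(1) g by auto
    then have "|elts g| \<le>o |G|" using card_of_ordLeqI[OF inj, of "elts g" G] by auto
    then have "|elts g| <o ?K" using G(2) by (rule ordLeq_ordLess_trans)
    then have "card_less_in V g \<delta>" by (simp add: card_less_universe_iff[OF card])
    then obtain c where c: "c \<in> W" "elts c = {x \<in> elts S. \<forall>a\<in>elts g. x \<in> elts a}"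
      using W(3) g unfolding complete_over_def by auto
    have "elts c = elts S \<inter> \<Inter>G"
      unfolding c(2) \<open>elts ` elts g = G\<close>[symmetric] by auto
    with c(1) show "elts S \<inter> \<Inter>G \<in> elts ` W" by (metis image_eqI)
  qed
  moreover have "a \<in> elts ` W \<or> elts S - a \<in> elts ` W" if a: "a \<subseteq> elts S" for a
  proof -
    obtain a' where "elts a' = a" using subset_is_set[OF a] by blast
    then show ?thesis
      using W(2) a unfolding ultrafilter_over_def powerset_in_def by (auto simp: image_iff) metis
  qed
  ultimately show ?thesis unfolding complete_ultrafilter_def by blast
qed

lemma compact_universe:
  assumes "strongly_compact elts \<delta>" shows "compact_universe elts \<delta>"
proof
  show "cardinal_in V \<delta>" "infinite (elts \<delta>)"
    using assms countable_finite unfolding strongly_compact_def by auto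
qed (rule strongly_compact_extends[OF assms])

end

text \<open>\<open>T\<close> may live in any type and is first copied onto a subset of \<delta>.
  This supplies a cardinal \<open>l\<close> at which the completeness of \<open>U\<close> can be
  invoked.\<close>

lemma (in compact_universe) ex_cardinal_eqpoll:
  fixes T :: "'t set"
  assumes "|T| <o |elts \<delta>|"
  shows "\<exists>l\<in>elts \<delta>. cardinal_in (universe elts) l \<and> |T| =o |elts l|"
proof -
  obtain B where B: "B \<subseteq> elts \<delta>" "|T| =o |B|"
    using internalize_card_of_ordLess[of T "|elts \<delta>|"] assms by (auto simp: Field_card_of)
  obtain b where b: "elts b = B" using subset_is_set[OF B(1)] by blast
  then have "|elts b| <o |elts \<delta>|"
    using B(2) assms ordIso_ordLess_trans ordIso_symmetric by blast
  from card_below_cardinal[OF cardinal_delta this] B(2) b show ?thesis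
    using ordIso_transitive by blast
qed

section \<open>The ultrapower\<close>

text \<open>The function in \<open>eqpoll_in\<close> is external, so \<open>eqpoll_in\<close> is not literally first-order over \<open>M\<close>.
  This reformulation is, which makes it accessible to the theorem of Los.\<close>

lemma eqpoll_in_first_order:
  assumes ex: "\<forall>x\<in>univ M. \<forall>y\<in>univ M. \<exists>p\<in>univ M. pair_in M p x y"
    and unique: "\<forall>p\<in>univ M. \<forall>q\<in>univ M. ext M p = ext M q \<longrightarrow> p = q"
  shows "eqpoll_in M a b \<longleftrightarrow>
    (\<exists>h\<in>univ M.
       (\<forall>p\<in>ext M h. \<exists>x\<in>ext M a. \<exists>y\<in>ext M b. pair_in M p x y) \<and>
       (\<forall>x\<in>ext M a. \<exists>y\<in>ext M b. \<exists>p\<in>ext M h. pair_in M p x y) \<and>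
       (\<forall>y\<in>ext M b. \<exists>x\<in>ext M a. \<exists>p\<in>ext M h. pair_in M p x y) \<and>
       (\<forall>x\<in>ext M a. \<forall>x'\<in>ext M a. \<forall>y\<in>ext M b. \<forall>y'\<in>ext M b. \<forall>p\<in>ext M h. \<forall>q\<in>ext M h.
          pair_in M p x y \<and> pair_in M q x' y' \<longrightarrow> (x = x' \<longleftrightarrow> y = y')))"
    (is "_ \<longleftrightarrow> (\<exists>h\<in>univ M. ?graph h)")
proof
  have univ: "x \<in> univ M" if "x \<in> ext M c" for x c using that unfolding ext_def by auto
  {
    assume "eqpoll_in M a b"
    then obtain h f where h: "h \<in> univ M" and f: "bij_betw f (ext M a) (ext M b)"
      and H: "ext M h = {p \<in> univ M. \<exists>x\<in>ext M a. pair_in M p x (f x)}"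
      unfolding eqpoll_in_def by blast
    have fb: "f x \<in> ext M b" if "x \<in> ext M a" for x using f that by (auto simp: bij_betw_def)
    have total: "\<exists>p\<in>ext M h. pair_in M p x (f x)" if "x \<in> ext M a" for x
      using ex univ[OF that] univ[OF fb[OF that]] that unfolding H by blast
    have val: "y = f x" if "p \<in> ext M h" "pair_in M p x y" for p x y
      using that(1) pair_in_inject[OF that(2)] unfolding H by blast
    have surj: "\<exists>x\<in>ext M a. y = f x" if "y \<in> ext M b" for y
      using f that by (auto simp: bij_betw_def)
    have inj: "x = x' \<longleftrightarrow> f x = f x'" if "x \<in> ext M a" "x' \<in> ext M a" for x x'
      using f that by (auto simp: bij_betw_def dest: inj_onD)
    have "?graph h"
    proof (intro conjI)
      show "\<forall>p\<in>ext M h. \<exists>x\<in>ext M a. \<exists>y\<in>ext M b. pair_in M p x y"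
        using fb unfolding H by blast
      show "\<forall>x\<in>ext M a. \<exists>y\<in>ext M b. \<exists>p\<in>ext M h. pair_in M p x y"
        using fb total by blast
      show "\<forall>y\<in>ext M b. \<exists>x\<in>ext M a. \<exists>p\<in>ext M h. pair_in M p x y"
        using surj total by blast
      show "\<forall>x\<in>ext M a. \<forall>x'\<in>ext M a. \<forall>y\<in>ext M b. \<forall>y'\<in>ext M b. \<forall>p\<in>ext M h. \<forall>q\<in>ext M h.
          pair_in M p x y \<and> pair_in M q x' y' \<longrightarrow> (x = x' \<longleftrightarrow> y = y')"
        using val inj by blast
    qed
    with h show "\<exists>h\<in>univ M. ?graph h" by blast
  }
  assume "\<exists>h\<in>univ M. ?graph h"
  then obtain h where h: "h \<in> univ M"
    and total: "\<forall>p\<in>ext M h. \<exists>x\<in>ext M a. \<exists>y\<in>ext M b. pair_in M p x y"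
    and left: "\<forall>x\<in>ext M a. \<exists>y\<in>ext M b. \<exists>p\<in>ext M h. pair_in M p x y"
    and right: "\<forall>y\<in>ext M b. \<exists>x\<in>ext M a. \<exists>p\<in>ext M h. pair_in M p x y"
    and func: "\<forall>x\<in>ext M a. \<forall>x'\<in>ext M a. \<forall>y\<in>ext M b. \<forall>y'\<in>ext M b. \<forall>p\<in>ext M h. \<forall>q\<in>ext M h.
          pair_in M p x y \<and> pair_in M q x' y' \<longrightarrow> (x = x' \<longleftrightarrow> y = y')"
    by blast
  obtain f where f: "\<forall>x\<in>ext M a. f x \<in> ext M b \<and> (\<exists>p\<in>ext M h. pair_in M p x (f x))"
    using bchoice[OF left[unfolded Bex_def[of "ext M b"]]] by blast
  have val: "y = f x" if "p \<in> ext M h" "x \<in> ext M a" "y \<in> ext M b" "pair_in M p x y" for p x y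
    using func f that by blast
  have "inj_on f (ext M a)"
    by (intro inj_onI) (use f func in blast)
  moreover have "f ` ext M a = ext M b"
    using f right val by blast
  moreover have "ext M h = {p \<in> univ M. \<exists>x\<in>ext M a. pair_in M p x (f x)}"
  proof (intro equalityI subsetI)
    fix p assume "p \<in> ext M h"
    then show "p \<in> {p \<in> univ M. \<exists>x\<in>ext M a. pair_in M p x (f x)}"
      using total val univ by blast
  next
    fix p assume "p \<in> {p \<in> univ M. \<exists>x\<in>ext M a. pair_in M p x (f x)}"
    then obtain x where p: "p \<in> univ M" "x \<in> ext M a" "pair_in M p x (f x)" by blast
    then obtain q where q: "q \<in> ext M h" "pair_in M q x (f x)" using f by blast
    \<comment> \<open>Pairs with the same components coincide by extensionality, so \<open>p\<close>
      is the pair \<open>q\<close> already in \<open>h\<close>.\<close>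
    obtain s t where st: "s \<in> univ M" "t \<in> univ M"
      "ext M s = {x}" "ext M t = {x, f x}" "ext M p = {s, t}"
      using p(3) unfolding pair_in_def by blast
    obtain s' t' where st': "s' \<in> univ M" "t' \<in> univ M"
      "ext M s' = {x}" "ext M t' = {x, f x}" "ext M q = {s', t'}"
      using q(2) unfolding pair_in_def by blast
    have "s = s'" "t = t'" using st st' by (auto intro: unique[rule_format])
    then have "p = q" using st(5) st'(5) p(1) univ[OF q(1)] by (auto intro: unique[rule_format])
    with q(1) show "p \<in> ext M h" by simp
  qed
  ultimately show "eqpoll_in M a b"
    using h unfolding eqpoll_in_def bij_betw_def by blast
qed

locale ultrapower_of_universe = zfc_universe elts for elts :: "'v \<Rightarrow> 'v set" +
  fixes I :: 'v and D :: "'v set"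
  assumes ultrafilter: "ultrafilter_over (universe elts) I D"
begin

abbreviation "AE \<equiv> ae elts I D"
abbreviation "cls \<equiv> ultra_class elts I D"
abbreviation "M \<equiv> ultrapower elts I D"

section \<open>Calculus of the almost-everywhere quantifier\<close>

lemma ae_mono:
  assumes "AE P" "\<And>i. i \<in> elts I \<Longrightarrow> P i \<Longrightarrow> Q i"
  shows "AE Q"
proof -
  obtain d where d: "d \<in> D" "elts d = {i\<in>elts I. P i}" using assms(1) unfolding ae_def by blast
  obtain e where e: "elts e = {i\<in>elts I. Q i}"
    using subset_is_set[of "{i\<in>elts I. Q i}" I] by auto
  have "elts d \<subseteq> elts e" "elts e \<subseteq> elts I" using assms(2) d(2) e by auto
  with d(1) have "e \<in> D"
    using ultrafilter unfolding ultrafilter_over_def filter_over_def powerset_in_def by auto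
  with e show ?thesis unfolding ae_def by blast
qed

lemma ae_cong:
  assumes "\<And>i. i \<in> elts I \<Longrightarrow> P i \<longleftrightarrow> Q i"
  shows "AE P \<longleftrightarrow> AE Q"
proof
  show "AE Q" if "AE P" using that by (rule ae_mono) (simp add: assms)
  show "AE P" if "AE Q" using that by (rule ae_mono) (simp add: assms)
qed

lemma ae_const [simp]: "AE (\<lambda>_. c) \<longleftrightarrow> c"
proof
  show c if "AE (\<lambda>_. c)"
    using ultrafilter that
    unfolding ae_def ultrafilter_over_def filter_over_def by (auto split: if_splits)
  show "AE (\<lambda>_. c)" if c
    using ultrafilter that unfolding ae_def ultrafilter_over_def filter_over_def by auto
qed

lemma ae_conj: "AE (\<lambda>i. P i \<and> Q i) \<longleftrightarrow> AE P \<and> AE Q"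
proof
  assume "AE P \<and> AE Q"
  then obtain a b where ab: "a \<in> D" "elts a = {i\<in>elts I. P i}" "b \<in> D" "elts b = {i\<in>elts I. Q i}"
    unfolding ae_def by blast
  have "\<forall>a\<in>D. \<forall>b\<in>D. \<exists>c\<in>D. elts c = elts a \<inter> elts b"
    using ultrafilter unfolding ultrafilter_over_def filter_over_def by simp
  with ab(1,3) obtain c where "c \<in> D" "elts c = elts a \<inter> elts b" by blast
  with ab show "AE (\<lambda>i. P i \<and> Q i)" unfolding ae_def by (intro bexI[of _ c]) auto
next
  assume *: "AE (\<lambda>i. P i \<and> Q i)"
  have "AE P" using * by (rule ae_mono) simp
  moreover have "AE Q" using * by (rule ae_mono) simp
  ultimately show "AE P \<and> AE Q" ..
qed

text \<open>The one rule that rests on the ultra half of \<open>ultrafilter\<close>; the rules for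
  disjunction and implication are derived from it.\<close>

lemma ae_not: "AE (\<lambda>i. \<not> P i) \<longleftrightarrow> \<not> AE P"
proof
  show "\<not> AE P" if "AE (\<lambda>i. \<not> P i)"
    using ae_conj[of P "\<lambda>i. \<not> P i"] that by simp
  assume P: "\<not> AE P"
  obtain a where a: "elts a = {i\<in>elts I. P i}"
    using subset_is_set[of "{i\<in>elts I. P i}" I] by auto
  then have "a \<notin> D" using P unfolding ae_def by blast
  then obtain c where "c \<in> D" "elts c = elts I - elts a"
    using ultrafilter a unfolding ultrafilter_over_def powerset_in_def by auto
  with a show "AE (\<lambda>i. \<not> P i)" unfolding ae_def by (intro bexI[of _ c]) auto
qed

lemma ae_disj: "AE (\<lambda>i. P i \<or> Q i) \<longleftrightarrow> AE P \<or> AE Q"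
  using ae_not[of "\<lambda>i. P i \<or> Q i"] unfolding de_Morgan_disj ae_conj ae_not by blast

lemma ae_imp: "AE (\<lambda>i. P i \<longrightarrow> Q i) \<longleftrightarrow> (AE P \<longrightarrow> AE Q)"
  unfolding imp_conv_disj ae_disj ae_not ..

lemma ae_iff: "AE (\<lambda>i. P i \<longleftrightarrow> Q i) \<longleftrightarrow> (AE P \<longleftrightarrow> AE Q)"
proof -
  have "AE (\<lambda>i. P i \<longleftrightarrow> Q i) \<longleftrightarrow> AE (\<lambda>i. (P i \<longrightarrow> Q i) \<and> (Q i \<longrightarrow> P i))"
    by (rule ae_cong) blast
  then show ?thesis unfolding ae_conj ae_imp by blast
qed

text \<open>Witnesses are chosen index by index with \<open>SOME\<close> and assembled into one
  function, which represents a member of \<open>M\<close>.\<close>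

lemma ae_ex: "AE (\<lambda>i. \<exists>x. Q i x) \<longleftrightarrow> (\<exists>g. AE (\<lambda>i. Q i (g i)))"
proof
  assume *: "AE (\<lambda>i. \<exists>x. Q i x)"
  have "AE (\<lambda>i. Q i (SOME x. Q i x))" by (rule ae_mono[OF *]) (auto intro: someI)
  then show "\<exists>g. AE (\<lambda>i. Q i (g i))" by (rule exI[where x = "\<lambda>i. SOME x. Q i x"])
next
  assume "\<exists>g. AE (\<lambda>i. Q i (g i))"
  then obtain g where "AE (\<lambda>i. Q i (g i))" ..
  then show "AE (\<lambda>i. \<exists>x. Q i x)" by (rule ae_mono) (rule exI)
qed

lemma ae_all: "AE (\<lambda>i. \<forall>x. Q i x) \<longleftrightarrow> (\<forall>g. AE (\<lambda>i. Q i (g i)))"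
  using ae_ex[of "\<lambda>i x. \<not> Q i x"] unfolding not_all[symmetric] ae_not by blast

text \<open>The induction steps of the theorem of Los: rewriting with these rules turns the statement that a
  formula holds almost everywhere into the statement that it holds in the ultrapower.\<close>

lemmas ae_push = ae_conj ae_not ae_disj ae_imp ae_iff ae_ex ae_all

section \<open>Transfer from the universe to the ultrapower\<close>

lemma univ_ultrapower: "univ M = range cls"
  by (simp add: ultrapower_def)

lemma cls_in_univ [simp]: "cls f \<in> univ M"
  by (simp add: univ_ultrapower)

lemma cls_eq_iff: "cls f = cls g \<longleftrightarrow> AE (\<lambda>i. f i = g i)"
proof
  assume "cls f = cls g"
  moreover have "g \<in> cls g" unfolding ultra_class_def by simp
  ultimately have "g \<in> cls f" by simp
  then show "AE (\<lambda>i. f i = g i)" unfolding ultra_class_def by simp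
next
  assume *: "AE (\<lambda>i. f i = g i)"
  have "AE (\<lambda>i. f i = h i) \<longleftrightarrow> AE (\<lambda>i. g i = h i)" for h
  proof
    show "AE (\<lambda>i. g i = h i)" if "AE (\<lambda>i. f i = h i)"
      by (rule ae_mono[OF iffD2[OF ae_conj conjI[OF * that]]]) metis
    show "AE (\<lambda>i. f i = h i)" if "AE (\<lambda>i. g i = h i)"
      by (rule ae_mono[OF iffD2[OF ae_conj conjI[OF * that]]]) metis
  qed
  then show "cls f = cls g" unfolding ultra_class_def by simp
qed

lemma mem_cls_iff: "mem M (cls f) (cls g) \<longleftrightarrow> AE (\<lambda>i. f i \<in> elts (g i))"
proof
  assume "mem M (cls f) (cls g)"
  then obtain f' g' where *: "AE (\<lambda>i. f i = f' i)" "AE (\<lambda>i. g i = g' i)" "AE (\<lambda>i. f' i \<in> elts (g' i))"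
    unfolding ultrapower_def ultra_class_def by auto
  then have "AE (\<lambda>i. f i = f' i \<and> g i = g' i \<and> f' i \<in> elts (g' i))" by (simp add: ae_conj)
  then show "AE (\<lambda>i. f i \<in> elts (g i))" by (rule ae_mono) simp
next
  assume "AE (\<lambda>i. f i \<in> elts (g i))"
  moreover have "f \<in> cls f" "g \<in> cls g" unfolding ultra_class_def by simp_all
  ultimately show "mem M (cls f) (cls g)"
    unfolding ultrapower_def set_structure.simps by (intro bexI)
qed

text \<open>Quantifiers over \<open>M\<close> become quantifiers over representing functions, the
  shape that \<open>ae_push\<close> produces.\<close>

lemma ball_univ: "(\<forall>x\<in>univ M. P x) \<longleftrightarrow> (\<forall>f. P (cls f))"
  and bex_univ: "(\<exists>x\<in>univ M. P x) \<longleftrightarrow> (\<exists>f. P (cls f))"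
  by (simp_all add: univ_ultrapower)

lemma in_ext_cls: "cls f \<in> ext M (cls g) \<longleftrightarrow> AE (\<lambda>i. f i \<in> elts (g i))"
  by (simp add: ext_def mem_cls_iff)

lemma ball_ext: "(\<forall>x\<in>ext M a. P x) \<longleftrightarrow> (\<forall>f. cls f \<in> ext M a \<longrightarrow> P (cls f))"
  and bex_ext: "(\<exists>x\<in>ext M a. P x) \<longleftrightarrow> (\<exists>f. cls f \<in> ext M a \<and> P (cls f))"
  by (auto simp: ext_def univ_ultrapower)

lemma ext_eq_iff: "ext M a = Z \<longleftrightarrow> Z \<subseteq> univ M \<and> (\<forall>f. cls f \<in> ext M a \<longleftrightarrow> cls f \<in> Z)"
  by (auto simp: ext_def univ_ultrapower)

lemma ext_subset_iff: "ext M a \<subseteq> ext M b \<longleftrightarrow> (\<forall>f. cls f \<in> ext M a \<longrightarrow> cls f \<in> ext M b)"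
  by (auto simp: ext_def univ_ultrapower)

lemma ext_subset_cls: "ext M (cls f) \<subseteq> ext M (cls g) \<longleftrightarrow> AE (\<lambda>i. elts (f i) \<subseteq> elts (g i))"
  unfolding ext_subset_iff in_ext_cls unfolding subset_eq Ball_def ae_push ..

lemma ext_inject: "\<forall>a\<in>univ M. \<forall>b\<in>univ M. ext M a = ext M b \<longrightarrow> a = b"
proof (intro ballI impI)
  fix a b assume "a \<in> univ M" "b \<in> univ M" and eq: "ext M a = ext M b"
  then obtain f g where ab: "a = cls f" "b = cls g" by (auto simp: univ_ultrapower)
  have "AE (\<lambda>i. \<forall>x. x \<in> elts (f i) \<longleftrightarrow> x \<in> elts (g i))"
    using eq unfolding ab ae_push in_ext_cls[symmetric] by simp
  then have "AE (\<lambda>i. f i = g i)" by (rule ae_mono) (auto intro: extensionality)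
  then show "a = b" unfolding ab cls_eq_iff .
qed

lemma los_singleton: "ext M (cls a) = {cls x} \<longleftrightarrow> AE (\<lambda>i. elts (a i) = {x i})"
  unfolding set_eq_iff[of "elts _"] ae_push insert_iff empty_iff
  by (simp add: ext_eq_iff in_ext_cls cls_eq_iff)

lemma los_doubleton: "ext M (cls a) = {cls x, cls y} \<longleftrightarrow> AE (\<lambda>i. elts (a i) = {x i, y i})"
  unfolding set_eq_iff[of "elts _"] ae_push insert_iff empty_iff
  by (simp add: ext_eq_iff in_ext_cls cls_eq_iff)

lemma los_pair:
  "pair_in M (cls p) (cls x) (cls y) \<longleftrightarrow> AE (\<lambda>i. pair_in V (p i) (x i) (y i))"
  unfolding pair_in_def bex_univ los_singleton los_doubleton
  by (simp add: ae_push)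

lemma ex_pair_ultrapower: "\<forall>x\<in>univ M. \<forall>y\<in>univ M. \<exists>p\<in>univ M. pair_in M p x y"
proof (intro ballI)
  fix x y assume "x \<in> univ M" "y \<in> univ M"
  then obtain f g where fg: "x = cls f" "y = cls g" by (auto simp: univ_ultrapower)
  have "AE (\<lambda>i. \<exists>p. pair_in V p (f i) (g i))" using ex_pair by simp
  then show "\<exists>p\<in>univ M. pair_in M p x y" unfolding fg bex_univ los_pair ae_ex .
qed

text \<open>Both sides are put in first-order form, one in \<open>M\<close> and one in
  \<open>V\<close>; then the quantifiers are pushed through \<open>AE\<close>.\<close>

lemma los_eqpoll: "eqpoll_in M (cls a) (cls b) \<longleftrightarrow> AE (\<lambda>i. eqpoll_in V (a i) (b i))"
proof -
  have ex: "\<forall>x\<in>univ V. \<forall>y\<in>univ V. \<exists>p\<in>univ V. pair_in V p x y"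
    using ex_pair by simp
  have uniq: "\<forall>p\<in>univ V. \<forall>q\<in>univ V. ext V p = ext V q \<longrightarrow> p = q"
    by (auto intro: extensionality)
  note V = eqpoll_in_first_order[where M = V, OF ex uniq]
  show ?thesis
    unfolding V eqpoll_in_first_order[OF ex_pair_ultrapower ext_inject]
      bex_univ ball_ext bex_ext in_ext_cls los_pair cls_eq_iff
    unfolding univ_universe ext_universe bex_UNIV
    unfolding Ball_def Bex_def ae_push ..
qed

lemma los_transitive: "transitive_in M (cls a) \<longleftrightarrow> AE (\<lambda>i. transitive_in V (a i))"
  unfolding transitive_in_def ball_ext in_ext_cls ext_subset_cls
  unfolding ext_universe Ball_def ae_push ..

lemma los_ordinal: "ordinal_in M (cls a) \<longleftrightarrow> AE (\<lambda>i. ordinal_in V (a i))"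
  unfolding ordinal_in_def ball_ext in_ext_cls los_transitive
  unfolding ext_universe Ball_def ae_push ..

lemma los_cardinal: "cardinal_in M (cls a) \<longleftrightarrow> AE (\<lambda>i. cardinal_in V (a i))"
  unfolding cardinal_in_def ball_ext in_ext_cls los_ordinal los_eqpoll
  unfolding ext_universe Ball_def ae_push
  by simp

lemma los_card_less: "card_less_in M (cls a) (cls b) \<longleftrightarrow> AE (\<lambda>i. card_less_in V (a i) (b i))"
  unfolding card_less_in_def bex_ext in_ext_cls los_cardinal los_eqpoll
  unfolding ext_universe Bex_def ae_push ..

end

section \<open>Complete ultrafilters on the ultrapower\<close>

text \<open>Any set of codes for all functions from \<open>I\<close> to \<open>Y\<close> will do; here these are all subsets of the
  product, a multi-valued one being read through \<open>SOME\<close>.\<close>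

lemma (in zfc_universe) ex_function_codes:
  "\<exists>S e. \<forall>x. (\<forall>i\<in>elts I. x i \<in> elts Y) \<longrightarrow> (\<exists>s\<in>elts S. \<forall>i\<in>elts I. e s i = x i)"
proof -
  obtain pr where pr: "\<And>x y. pair_in V (pr x y) x y" using ex_pair by metis
  have inj: "pr x y = pr x' y' \<longleftrightarrow> x = x' \<and> y = y'" for x y x' y'
    using pair_in_inject[OF pr[of x y]] pr[of x' y'] by metis
  \<comment> \<open>\<open>R i\<close> codes {i} x Y, so \<open>P\<close> is I x Y and
    \<open>S\<close> is the set of all its subsets.\<close>
  have "\<forall>i. \<exists>r. elts r = pr i ` elts Y" using replacement by blast
  then obtain R where R: "\<And>i. elts (R i) = pr i ` elts Y" by metis
  obtain Z where Z: "elts Z = R ` elts I" using replacement[of R I] by blast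
  obtain P where P: "elts P = \<Union> (elts ` elts Z)" using union by blast
  obtain S where S: "elts S = {z. elts z \<subseteq> elts P}" using powerset by blast
  define e where "e s i = (SOME y. pr i y \<in> elts s)" for s i
  have "\<exists>s\<in>elts S. \<forall>i\<in>elts I. e s i = x i" if x: "\<forall>i\<in>elts I. x i \<in> elts Y" for x
  proof -
    have sub: "(\<lambda>i. pr i (x i)) ` elts I \<subseteq> elts P" using x unfolding P Z image_image R by blast
    then obtain s where s: "elts s = (\<lambda>i. pr i (x i)) ` elts I" using subset_is_set by blast
    have "e s i = x i" if "i \<in> elts I" for i
      unfolding e_def s by (rule some_equality) (use that inj in auto)
    with s sub S show ?thesis by (intro bexI[of _ s]) auto
  qed
  then show ?thesis by blast
qed

locale complete_ultrafilter_on_ultrapower =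
  compact_universe elts \<delta> + ultrapower_of_universe elts I D
  for elts :: "'v \<Rightarrow> 'v set" and \<delta> I :: 'v and D :: "'v set" +
  fixes X :: "'v \<Rightarrow> 'v" and U :: "('v \<Rightarrow> 'v) set set"
  assumes card_I: "|elts I| <o |elts \<delta>|"
    and U: "ultrafilter_over (ultrapower elts I D) (ultra_class elts I D X) U"
    and U_complete: "\<And>\<gamma>. \<gamma> \<in> elts \<delta> \<Longrightarrow>
      complete_over (ultrapower elts I D) (ultra_class elts I D X) U (ultrapower_embedding elts I D \<gamma>)"
begin

lemma U_meet:
  assumes "cls f \<in> U" "cls g \<in> U"
  shows "\<exists>y. AE (\<lambda>i. y i \<in> elts (f i)) \<and> AE (\<lambda>i. y i \<in> elts (g i))"
proof -
  have "\<forall>a\<in>U. \<forall>b\<in>U. \<exists>c\<in>U. ext M c = ext M a \<inter> ext M b" "\<forall>a\<in>U. ext M a \<noteq> {}"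
    using U unfolding ultrafilter_over_def filter_over_def by simp_all
  with assms have "ext M (cls f) \<inter> ext M (cls g) \<noteq> {}" by metis
  then obtain a where a: "a \<in> ext M (cls f)" "a \<in> ext M (cls g)" by blast
  then obtain y where "a = cls y" unfolding ext_def univ_ultrapower by blast
  with a show ?thesis by (auto simp: in_ext_cls)
qed

lemma U_compl:
  assumes "cls f \<notin> U" "AE (\<lambda>i. elts (f i) \<subseteq> elts (X i))"
  shows "\<exists>h. cls h \<in> U \<and> AE (\<lambda>i. elts (h i) = elts (X i) - elts (f i))"
proof -
  have "cls f \<in> powerset_in M (cls X)"
    using assms(2) by (simp add: powerset_in_def ext_subset_cls)
  then obtain c where c: "c \<in> U" "ext M c = ext M (cls X) - ext M (cls f)"
    using U assms(1) unfolding ultrafilter_over_def by blast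
  moreover have "U \<subseteq> univ M"
    using U unfolding ultrafilter_over_def filter_over_def powerset_in_def by blast
  ultimately obtain h where h: "c = cls h" unfolding univ_ultrapower by blast
  have "AE (\<lambda>i. g i \<in> elts (h i)) \<longleftrightarrow> AE (\<lambda>i. g i \<in> elts (X i)) \<and> \<not> AE (\<lambda>i. g i \<in> elts (f i))" for g
    using c(2) unfolding h in_ext_cls[symmetric] by simp
  then have "AE (\<lambda>i. elts (h i) = elts (X i) - elts (f i))"
    unfolding set_eq_iff[of "elts _"] Diff_iff ae_push by simp
  with c(1) h show ?thesis by blast
qed

text \<open>Partition \<open>X i\<close> according to the traces of the members of \<open>A\<close>. In \<open>M\<close> there are fewer than
  \<open>j(\<delta>)\<close> pieces because \<open>\<delta>\<close> is a strong limit, so one of them is in \<open>U\<close>.\<close>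

lemma ex_simultaneous_point:
  fixes A :: "('v \<Rightarrow> 'v) set"
  assumes A: "|A| <o |elts \<delta>|" and sub: "\<And>f i. f \<in> A \<Longrightarrow> elts (f i) \<subseteq> elts (X i)"
  shows "\<exists>x. AE (\<lambda>i. x i \<in> elts (X i)) \<and> (\<forall>f\<in>A. cls f \<in> U \<longleftrightarrow> AE (\<lambda>i. x i \<in> elts (f i)))"
proof -
  \<comment> \<open>The pieces are indexed by subsets of \<open>A\<close>, so there are at most
    |P(A)| of them. One more power set makes this bound strict, and two uses of
    \<open>strong_limit_delta\<close> keep it below \<delta>.\<close>
  obtain l where l: "l \<in> elts \<delta>" "cardinal_in V l" "|Pow (Pow A)| =o |elts l|"
    using ex_cardinal_eqpoll[OF strong_limit_delta[OF strong_limit_delta[OF A]]] by blast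
  define piece where "piece i s = {x\<in>elts (X i). \<forall>f\<in>A. x \<in> elts (f i) \<longleftrightarrow> f \<in> s}" for i s
  \<comment> \<open>Complements of pieces: if all of them lay in \<open>U\<close>, so would their
    intersection, which is empty.\<close>
  have "\<forall>i s. \<exists>q. elts q = elts (X i) - piece i s" using subset_is_set by blast
  then obtain q where q: "\<And>i s. elts (q i s) = elts (X i) - piece i s" by metis
  have "\<exists>F. elts F = q i ` Pow A" for i
  proof -
    obtain P where "elts P = {z. elts z \<subseteq> elts (X i)}" using powerset by blast
    then have "q i ` Pow A \<subseteq> elts P" using q by auto
    then show ?thesis by (rule subset_is_set)
  qed
  then obtain F where F: "\<And>i. elts (F i) = q i ` Pow A" by metis
  have "card_less_in V (F i) l" for i
  proof -
    have "|elts (F i)| \<le>o |Pow A|" unfolding F by (rule card_of_image)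
    then have "|elts (F i)| <o |Pow (Pow A)|" using card_of_Pow by (rule ordLeq_ordLess_trans)
    then have "|elts (F i)| <o |elts l|" using l(3) by (rule ordLess_ordIso_trans)
    then show ?thesis unfolding card_less_universe_iff[OF l(2)] .
  qed
  then have small: "card_less_in M (cls F) (ultrapower_embedding elts I D l)"
    unfolding ultrapower_embedding_def los_card_less by simp
  have "\<not> ext M (cls F) \<subseteq> U"
  proof
    assume "ext M (cls F) \<subseteq> U"
    with small U_complete[OF l(1)] obtain c where
      c: "c \<in> U" "ext M c = {x \<in> ext M (cls X). \<forall>a\<in>ext M (cls F). x \<in> ext M a}"
      unfolding complete_over_def using cls_in_univ by blast
    have "ext M c \<noteq> {}" using U c(1) unfolding ultrafilter_over_def filter_over_def by blast
    then obtain y where y: "cls y \<in> ext M c" unfolding ext_def univ_ultrapower by blast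
    have yX: "AE (\<lambda>i. y i \<in> elts (X i))" using y unfolding c(2) by (simp add: in_ext_cls)
    \<comment> \<open>The complement of the very piece that contains \<open>y i\<close>, so
      \<open>y\<close> would have to avoid its own piece.\<close>
    let ?a = "\<lambda>i. q i {f\<in>A. y i \<in> elts (f i)}"
    have "AE (\<lambda>i. ?a i \<in> elts (F i))" unfolding F by (rule ae_mono[of "\<lambda>_. True"]) auto
    then have "cls ?a \<in> ext M (cls F)" by (simp add: in_ext_cls)
    then have "cls y \<in> ext M (cls ?a)" using y unfolding c(2) by blast
    then have "AE (\<lambda>i. y i \<in> elts (?a i))" by (simp add: in_ext_cls)
    with yX have "AE (\<lambda>i. y i \<in> elts (X i) \<and> y i \<in> elts (?a i))" by (simp add: ae_conj)
    then have "AE (\<lambda>i. False)" by (rule ae_mono) (auto simp: q piece_def)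
    then show False by simp
  qed
  then obtain a where a: "cls a \<in> ext M (cls F)" "cls a \<notin> U"
    unfolding ext_def univ_ultrapower by blast
  \<comment> \<open>The index of the chosen piece may vary with \<open>i\<close>, so it is a
    function \<open>s\<close>; \<open>h\<close> below represents that piece.\<close>
  from a(1) have "AE (\<lambda>i. \<exists>s. a i = q i s)"
    unfolding in_ext_cls by (rule ae_mono) (auto simp: F)
  then obtain s where s: "AE (\<lambda>i. a i = q i (s i))" unfolding ae_ex by blast
  then have "AE (\<lambda>i. elts (a i) \<subseteq> elts (X i))" by (rule ae_mono) (simp add: q)
  with a(2) obtain h where h: "cls h \<in> U" "AE (\<lambda>i. elts (h i) = elts (X i) - elts (a i))"
    using U_compl by blast
  from h(2) s have "AE (\<lambda>i. elts (h i) = elts (X i) - elts (a i) \<and> a i = q i (s i))"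
    by (simp add: ae_conj)
  then have hp: "AE (\<lambda>i. elts (h i) = piece i (s i))"
    by (rule ae_mono) (auto simp: q piece_def)
  have in_piece: "AE (\<lambda>i. y i \<in> piece i (s i))" if "AE (\<lambda>i. y i \<in> elts (h i))" for y
  proof -
    from that hp have "AE (\<lambda>i. y i \<in> elts (h i) \<and> elts (h i) = piece i (s i))"
      by (simp add: ae_conj)
    then show ?thesis by (rule ae_mono) auto
  qed
  have trace: "AE (\<lambda>i. y i \<in> elts (f i)) \<longleftrightarrow> AE (\<lambda>i. f \<in> s i)"
    if "AE (\<lambda>i. y i \<in> elts (h i))" "f \<in> A" for y f
  proof -
    have "AE (\<lambda>i. y i \<in> elts (f i) \<longleftrightarrow> f \<in> s i)"
      using in_piece[OF that(1)] by (rule ae_mono) (use that(2) in \<open>auto simp: piece_def\<close>)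
    then show ?thesis by (simp add: ae_iff)
  qed
  \<comment> \<open>Any point of \<open>cls h\<close> works, since all have the trace
    \<open>s\<close> on \<open>A\<close>: \<open>f\<close> or its complement is in \<open>U\<close>
    and so meets \<open>cls h\<close>, and the trace of the meeting point is also that of
    \<open>x\<close>.\<close>
  obtain x where x: "AE (\<lambda>i. x i \<in> elts (h i))" using U_meet[OF h(1) h(1)] by blast
  have "cls f \<in> U \<longleftrightarrow> AE (\<lambda>i. x i \<in> elts (f i))" if f: "f \<in> A" for f
  proof (cases "cls f \<in> U")
    case True
    then obtain y where "AE (\<lambda>i. y i \<in> elts (f i))" "AE (\<lambda>i. y i \<in> elts (h i))"
      using U_meet[OF True h(1)] by blast
    with True show ?thesis using trace[OF _ f] x by blast
  next
    case False
    then obtain g where g: "cls g \<in> U" "AE (\<lambda>i. elts (g i) = elts (X i) - elts (f i))"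
      using U_compl[OF False] sub[OF f] by auto
    then obtain y where y: "AE (\<lambda>i. y i \<in> elts (g i))" "AE (\<lambda>i. y i \<in> elts (h i))"
      using U_meet[OF g(1) h(1)] by blast
    then have "AE (\<lambda>i. elts (g i) = elts (X i) - elts (f i) \<and> y i \<in> elts (g i))"
      using g(2) by (simp add: ae_conj)
    then have "AE (\<lambda>i. \<not> y i \<in> elts (f i))" by (rule ae_mono) auto
    with False show ?thesis using trace[OF _ f] x y(2) unfolding ae_not by blast
  qed
  moreover have "AE (\<lambda>i. x i \<in> elts (X i))"
    using in_piece[OF x] by (rule ae_mono) (simp add: piece_def)
  ultimately show ?thesis by blast
qed

lemma ultrafilter_internal: "\<exists>g. ext M (cls g) = U"
proof -
  let ?K = "|elts \<delta>|"
  obtain Z where "elts Z = X ` elts I" using replacement[of X I] by blast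
  moreover obtain Y where "elts Y = \<Union> (elts ` elts Z)" using union by blast
  ultimately have Y: "elts Y = (\<Union>i\<in>elts I. elts (X i))" by simp
  obtain S e where code:
    "\<And>x. \<forall>i\<in>elts I. x i \<in> elts Y \<Longrightarrow> \<exists>s\<in>elts S. \<forall>i\<in>elts I. e s i = x i"
    using ex_function_codes[of I Y] by blast
  \<comment> \<open>Representatives that are subsets of \<open>X i\<close> at every index, not only
    almost everywhere, so that pointwise arguments apply.\<close>
  define P where "P = {f. \<forall>i. elts (f i) \<subseteq> elts (X i)}"
  define B where "B f = {s\<in>elts S. cls f \<in> U \<longleftrightarrow> AE (\<lambda>i. e s i \<in> elts (f i))}" for f
  define F where "F = {Z. Z \<subseteq> elts S \<and>
    (\<exists>A\<subseteq>P. |A| <o ?K \<and> {s\<in>elts S. \<forall>f\<in>A. s \<in> B f} \<subseteq> Z)}"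
  have nonempty: "{s\<in>elts S. \<forall>f\<in>A. s \<in> B f} \<noteq> {}" if A: "A \<subseteq> P" "|A| <o ?K" for A
  proof -
    obtain x where x: "AE (\<lambda>i. x i \<in> elts (X i))"
      "\<forall>f\<in>A. cls f \<in> U \<longleftrightarrow> AE (\<lambda>i. x i \<in> elts (f i))"
      using ex_simultaneous_point[OF A(2)] A(1) unfolding P_def by blast
    have "elts Y \<noteq> {}"
    proof
      assume "elts Y = {}"
      then have "AE (\<lambda>i. False)" by (intro ae_mono[OF x(1)]) (auto simp: Y)
      then show False by simp
    qed
    then obtain y0 where y0: "y0 \<in> elts Y" by blast
    \<comment> \<open>\<open>x\<close> may leave \<open>Y\<close> on a null set of indices; the
      default \<open>y0\<close> yields a function that has a code.\<close>
    define x' where "x' i = (if x i \<in> elts Y then x i else y0)" for i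
    have "\<forall>i\<in>elts I. x' i \<in> elts Y" using y0 unfolding x'_def by simp
    then obtain s where s: "s \<in> elts S" "\<forall>i\<in>elts I. e s i = x' i" using code by blast
    have "AE (\<lambda>i. e s i = x i)"
      using x(1) by (rule ae_mono) (use s(2) in \<open>auto simp: x'_def Y\<close>)
    then have "AE (\<lambda>i. e s i \<in> elts (f i) \<longleftrightarrow> x i \<in> elts (f i))" for f
      by (rule ae_mono) simp
    then have "AE (\<lambda>i. e s i \<in> elts (f i)) \<longleftrightarrow> AE (\<lambda>i. x i \<in> elts (f i))" for f
      by (simp add: ae_iff)
    then have "\<forall>f\<in>A. s \<in> B f" using x(2) s(1) unfolding B_def by simp
    with s(1) show ?thesis by blast
  qed
  have "complete_filter ?K (elts S) F"
    unfolding complete_filter_def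
  proof (intro conjI ballI allI impI)
    show "F \<subseteq> Pow (elts S)" unfolding F_def by blast
    show "{} \<notin> F" using nonempty unfolding F_def by blast
    show "b \<in> F" if "a \<in> F" "a \<subseteq> b \<and> b \<subseteq> elts S" for a b
      using that unfolding F_def by blast
  next
    fix G assume G: "G \<subseteq> F" "|G| <o ?K"
    then have "\<forall>Z\<in>G. \<exists>A. A \<subseteq> P \<and> |A| <o ?K \<and> {s\<in>elts S. \<forall>f\<in>A. s \<in> B f} \<subseteq> Z"
      unfolding F_def by blast
    from bchoice[OF this] obtain A where *: "\<forall>Z\<in>G. A Z \<subseteq> P \<and> |A Z| <o ?K \<and>
        {s\<in>elts S. \<forall>f\<in>A Z. s \<in> B f} \<subseteq> Z" ..
    have A: "A Z \<subseteq> P" "|A Z| <o ?K" "{s\<in>elts S. \<forall>f\<in>A Z. s \<in> B f} \<subseteq> Z" if "Z \<in> G" for Z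
      using bspec[OF * that] by simp_all
    \<comment> \<open>Regularity: fewer than \<delta> generating families of size less than \<delta>
      merge into one.\<close>
    have "|\<Union>Z\<in>G. A Z| <o ?K" using stable_UNION[OF stable_delta G(2) A(2)] .
    moreover have "(\<Union>Z\<in>G. A Z) \<subseteq> P" using A(1) by blast
    moreover have "{s\<in>elts S. \<forall>f\<in>(\<Union>Z\<in>G. A Z). s \<in> B f} \<subseteq> elts S \<inter> \<Inter>G"
      using A(3) by blast
    ultimately show "elts S \<inter> \<Inter>G \<in> F" unfolding F_def by blast
  qed
  then obtain W where W: "F \<subseteq> W" "complete_ultrafilter ?K (elts S) W" using extends by blast
  then have kW: "complete_filter ?K (elts S) W" unfolding complete_ultrafilter_def by simp
  have BW: "B f \<in> W" if "f \<in> P" for f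
  proof -
    have "|{f}| <o ?K" using infinite_delta by (simp add: card_of_finite_less)
    then have "B f \<in> F"
      using that unfolding F_def by (auto simp: B_def intro!: exI[of _ "{f}"])
    then show ?thesis using W(1) by blast
  qed
  \<comment> \<open>\<open>g i\<close> is the image of \<open>W\<close> under the map from a code
    \<open>s\<close> to \<open>e s i\<close>, restricted to subsets of \<open>X i\<close>.\<close>
  have "\<exists>g. elts g = {y. elts y \<subseteq> elts (X i) \<and> {s\<in>elts S. e s i \<in> elts y} \<in> W}" for i
  proof -
    obtain Q where "elts Q = {z. elts z \<subseteq> elts (X i)}" using powerset by blast
    then show ?thesis
      using subset_is_set[of "{y. elts y \<subseteq> elts (X i) \<and> {s\<in>elts S. e s i \<in> elts y} \<in> W}" Q]
      by blast
  qed
  then obtain g where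
    g: "\<And>i. elts (g i) = {y. elts y \<subseteq> elts (X i) \<and> {s\<in>elts S. e s i \<in> elts y} \<in> W}"
    by metis
  have key: "cls f \<in> U \<longleftrightarrow> AE (\<lambda>i. f i \<in> elts (g i))" if f: "f \<in> P" for f
  proof -
    define C where "C i = {s\<in>elts S. e s i \<in> elts (f i) \<longleftrightarrow> f i \<in> elts (g i)}" for i
    have "C i \<in> W" for i
    proof -
      have "elts S - {s\<in>elts S. e s i \<in> elts (f i)} = {s\<in>elts S. e s i \<notin> elts (f i)}" by blast
      moreover have "{s\<in>elts S. e s i \<in> elts (f i)} \<in> W
          \<or> elts S - {s\<in>elts S. e s i \<in> elts (f i)} \<in> W"
        using W(2) by (auto simp: complete_ultrafilter_def)
      moreover have "f i \<in> elts (g i) \<longleftrightarrow> {s\<in>elts S. e s i \<in> elts (f i)} \<in> W"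
        using f unfolding g P_def by simp
      ultimately show ?thesis
        unfolding C_def by (cases "f i \<in> elts (g i)") simp_all
    qed
    \<comment> \<open>Since |I| < \<delta>, all indices are handled at once; a code that is also in
      \<open>B f\<close> then links \<open>U\<close> with \<open>g\<close>.\<close>
    then have "{s\<in>elts S. \<forall>i\<in>elts I. s \<in> C i} \<in> W"
      by (intro complete_filter_INT[OF kW card_I])
    then obtain s where s: "s \<in> B f" "\<forall>i\<in>elts I. s \<in> C i"
      using complete_filter_disjoint[OF kW infinite_delta BW[OF f]] by blast
    have "cls f \<in> U \<longleftrightarrow> AE (\<lambda>i. e s i \<in> elts (f i))" using s(1) unfolding B_def by simp
    also have "\<dots> \<longleftrightarrow> AE (\<lambda>i. f i \<in> elts (g i))"
      by (rule ae_cong) (use s(2) in \<open>auto simp: C_def\<close>)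
    finally show ?thesis .
  qed
  \<comment> \<open>The empty set is the default at the null set of indices where \<open>f i\<close>
    is not a subset of \<open>X i\<close>.\<close>
  obtain em where em: "elts em = {}" using infinity by blast
  have normalize: "\<exists>f'\<in>P. cls f' = cls f" if "AE (\<lambda>i. elts (f i) \<subseteq> elts (X i))" for f
  proof (rule bexI)
    let ?f = "\<lambda>i. if elts (f i) \<subseteq> elts (X i) then f i else em"
    show "?f \<in> P" unfolding P_def by (simp add: em)
    show "cls ?f = cls f" unfolding cls_eq_iff using that by (rule ae_mono) simp
  qed
  have "cls f \<in> ext M (cls g) \<longleftrightarrow> cls f \<in> U" for f
  proof (cases "AE (\<lambda>i. elts (f i) \<subseteq> elts (X i))")
    case True
    then obtain f' where f': "f' \<in> P" "cls f' = cls f" using normalize by blast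
    have "cls f' \<in> ext M (cls g) \<longleftrightarrow> cls f' \<in> U" using key[OF f'(1)] by (simp add: in_ext_cls)
    with f'(2) show ?thesis by simp
  next
    \<comment> \<open>A class that is not a subset of \<open>cls X\<close> in \<open>M\<close> lies
      on neither side.\<close>
    case False
    have "AE (\<lambda>i. elts (f i) \<subseteq> elts (X i))" if "AE (\<lambda>i. f i \<in> elts (g i))"
      using that by (rule ae_mono) (simp add: g)
    moreover have "AE (\<lambda>i. elts (f i) \<subseteq> elts (X i))" if "cls f \<in> U"
      using U that unfolding ultrafilter_over_def filter_over_def powerset_in_def
      by (auto simp: ext_subset_cls)
    ultimately show ?thesis using False unfolding in_ext_cls by blast
  qed
  moreover have "U \<subseteq> univ M"
    using U unfolding ultrafilter_over_def filter_over_def powerset_in_def by blast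
  ultimately have "ext M (cls g) = U" unfolding ext_eq_iff by blast
  then show ?thesis by blast
qed

end

theorem theorem3p5:
  fixes elts :: "'v \<Rightarrow> 'v set" and \<delta> I :: 'v and D :: "'v set"
    and X :: "('v \<Rightarrow> 'v) set" and U :: "('v \<Rightarrow> 'v) set set"
  assumes "zfc_universe elts"
    and "strongly_compact elts \<delta>"
    and "card_less_in (universe elts) I \<delta>"
    and "ultrafilter_over (universe elts) I D"
    and "X \<in> univ (ultrapower elts I D)"
    and "ultrafilter_over (ultrapower elts I D) X U"
    and "\<And>\<gamma>. \<gamma> \<in> elts \<delta> \<Longrightarrow>
           complete_over (ultrapower elts I D) X U (ultrapower_embedding elts I D \<gamma>)"
  shows "\<exists>u\<in>univ (ultrapower elts I D). ext (ultrapower elts I D) u = U"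
proof -
  interpret compact_universe elts \<delta>
    using assms(1,2) by (rule zfc_universe.compact_universe)
  interpret ultrapower_of_universe elts I D
    by unfold_locales (rule assms(4))
  obtain X' where X': "X = cls X'" using assms(5) unfolding univ_ultrapower by blast
  interpret complete_ultrafilter_on_ultrapower elts \<delta> I D X' U
    by unfold_locales
      (use assms(3,6,7) X' card_less_universe_iff[OF cardinal_delta] in simp_all)
  show ?thesis using ultrafilter_internal by auto
qed

end
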